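(* Let $n\in\mathbb{N}$, $a\in\mathbb{R}$, and let $f$ be an arbitrary differentiable function (for which the fractional derivatives below exist). Then \[ (\partial_x)^{a}\,[\phi_n(x) f(x)] = \sum_{m=0}^{n}\sum_{u=0}^{m}\binom{n}{m}\,S_2(m,u)\,\phi_{n-m}(x)\,(a)_{u}\,(\partial_x)^{a-u}[f(x)]. \]
   Context: $S_2(n,m)$ are the Stirling numbers of the second kind, and $\phi_n(x)=\sum_{m=0}^n S_2(n,m)x^m$ are the exponential polynomials, with generating function $e^{x(e^t-1)}=\sum_{m\ge0}\frac{\phi_m(x)t^m}{m!}$. $(a)_m = a(a-1)\cdots(a-m+1)$ is the falling factorial, $(a)_0=1$, and $\binom{a}{m}=(a)_m/m!$. For $a\in\mathbb{R}$, $(\partial_x)^a$ denotes fractional differentiation of order $a$ with respect to $x$: a family of linear operators which agree with the ordinary derivative of order $a$ when $a$ is a nonnegative integer and which obey the extension of the general Leibniz rule to real order: for a polynomial $p$ and a function $f$ for which the terms exist, \[ (\partial_x)^a[p(x)f(x)] = \sum_{m=0}^{\infty}\binom{a}{m}\,(\partial_x)^{a-m}[f(x)]\;p^{(m)}(x). \] *)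

theory Defs
  imports "HOL-Analysis.Analysis" "HOL-Computational_Algebra.Polynomial" "HOL-Combinatorics.Stirling"
begin

definition exponential_poly :: "nat \<Rightarrow> real poly" where
  "exponential_poly n = (\<Sum>m=0..n. monom (real (Stirling n m)) m)"

definition falling_factorial :: "real \<Rightarrow> nat \<Rightarrow> real" where
  "falling_factorial a m = (\<Prod>i<m. a - real i)"

definition times_differentiable_on :: "nat \<Rightarrow> (real \<Rightarrow> real) \<Rightarrow> real set \<Rightarrow> bool" where
  "times_differentiable_on k f S \<longleftrightarrow> (\<forall>i<k. ((deriv ^^ i) f) differentiable_on S)"

text \<open>
  A family of fractional differentiation operators acting on functions of a variable ranging over
  an open set \<open>S\<close> of reals (e.g. \<open>{0<..}\<close> or \<open>UNIV\<close>). The operators are partial: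
  \<open>f \<in> dom a\<close> says that the derivative of order \<open>a\<close> of \<open>f\<close> exists, and it is then
  \<open>D a f\<close>; outside \<open>dom a\<close> the value of \<open>D a f\<close> is meaningless. Functions are total in HOL,
  but only values at points of \<open>S\<close> are constrained.

  In the Leibniz rule a term exists if its coefficient vanishes (it is then zero by convention) or
  if the fractional derivative in it exists. In particular only the terms with
  \<open>m \<le> degree p\<close> matter, and for a natural number \<open>a\<close> only those with \<open>m \<le> a\<close>.
\<close>

locale fractional_differentiation =
  fixes S :: "real set"
    and dom :: "real \<Rightarrow> (real \<Rightarrow> real) set"
    and D :: "real \<Rightarrow> (real \<Rightarrow> real) \<Rightarrow> real \<Rightarrow> real"
  assumes open_S: "open S"
    and dom_zero: "(\<lambda>_. 0) \<in> dom a"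
    and dom_linear: "f \<in> dom a \<Longrightarrow> g \<in> dom a \<Longrightarrow> (\<lambda>x. c * f x + d * g x) \<in> dom a"
    and linear: "f \<in> dom a \<Longrightarrow> g \<in> dom a \<Longrightarrow> x \<in> S \<Longrightarrow>
      D a (\<lambda>x. c * f x + d * g x) x = c * D a f x + d * D a g x"
    and dom_ordinary: "times_differentiable_on k f S \<Longrightarrow> f \<in> dom (real k)"
    and ordinary: "times_differentiable_on k f S \<Longrightarrow> x \<in> S \<Longrightarrow>
      D (real k) f x = (deriv ^^ k) f x"
    and Leibniz: "(\<lambda>x. poly p x * f x) \<in> dom a \<Longrightarrow>
      (\<And>m. m \<le> degree p \<Longrightarrow> a gchoose m \<noteq> 0 \<Longrightarrow> f \<in> dom (a - real m)) \<Longrightarrow> x \<in> S \<Longrightarrow>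
      (\<lambda>m. (a gchoose m) * D (a - real m) f x * poly ((pderiv ^^ m) p) x)
        sums D a (\<lambda>x. poly p x * f x) x"

end

theory Submission
  imports Defs
begin

text \<open>
  Comparing coefficients, the convolution identity
  \<open>((i + j) choose i) S\<^sub>2(n, i + j) = (\<Sum>m\<le>n. (n choose m) S\<^sub>2(m, i) S\<^sub>2(n - m, j))\<close>
  expresses the \<open>u\<close>-th derivative of \<open>\<phi>\<^sub>n\<close> as
  \<open>u! (\<Sum>m\<le>n. (n choose m) S\<^sub>2(m, u) \<phi>\<^bsub>n-m\<^esub>)\<close>. Substituting this into the
  Leibniz rule, whose series stops at \<open>n\<close>, and cancelling \<open>u!\<close> against the denominator of
  \<open>a gchoose u\<close> gives the theorem.
\<close>

text \<open>Pascal's rule; for exponential generating functions this is the product rule (FG)' = F'G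
  + FG'.\<close>

lemma binomial_convolution_Suc:
  fixes f g :: "nat \<Rightarrow> 'a::comm_semiring_1"
  shows "(\<Sum>m\<le>Suc n. of_nat (Suc n choose m) * f m * g (Suc n - m)) =
    (\<Sum>m\<le>n. of_nat (n choose m) * f (Suc m) * g (n - m)) +
    (\<Sum>m\<le>n. of_nat (n choose m) * f m * g (Suc (n - m)))"
proof -
  \<comment> \<open>The extra term m = n + 1 is harmless because \<open>n choose Suc n\<close> is
    0.\<close>
  have "(\<Sum>m\<le>n. of_nat (n choose m) * f m * g (Suc (n - m))) =
      (\<Sum>m\<le>Suc n. of_nat (n choose m) * f m * g (Suc n - m))"
    by (simp add: Suc_diff_le binomial_eq_0)
  also have "\<dots> = f 0 * g (Suc n) +
      (\<Sum>m\<le>n. of_nat (n choose Suc m) * f (Suc m) * g (n - m))"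
    by (subst sum.atMost_Suc_shift) simp
  finally show ?thesis
    by (subst sum.atMost_Suc_shift) (simp add: sum.distrib algebra_simps)
qed

text \<open>Both sides count partitions of an n-set into i + j blocks, i of them marked; on the
  right, m elements lie in marked blocks. The formal proof is an induction on n by the Stirling
  recurrence.\<close>

lemma Stirling_convolution:
  "((i + j) choose i) * Stirling n (i + j) =
    (\<Sum>m\<le>n. (n choose m) * Stirling m i * Stirling (n - m) j)"
proof (induction n arbitrary: i j)
  case 0
  show ?case by (cases i; cases j) simp_all
next
  case (Suc n)
  let ?T = "\<lambda>i j. \<Sum>m\<le>n. (n choose m) * Stirling m i * Stirling (n - m) j"
  have rec: "(\<Sum>m\<le>Suc n. (Suc n choose m) * Stirling m i * Stirling (Suc n - m) j) =
      (\<Sum>m\<le>n. (n choose m) * Stirling (Suc m) i * Stirling (n - m) j) +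
      (\<Sum>m\<le>n. (n choose m) * Stirling m i * Stirling (Suc (n - m)) j)" for i j
    using binomial_convolution_Suc[where 'a = nat and n = n and f = "\<lambda>m. Stirling m i" and g = "\<lambda>m. Stirling m j"]
    by simp
  have left: "(\<Sum>m\<le>n. (n choose m) * Stirling (Suc m) (Suc k) * Stirling (n - m) j) =
      Suc k * ?T (Suc k) j + ?T k j" for k j
    by (simp add: sum.distrib sum_distrib_left algebra_simps)
  have right: "(\<Sum>m\<le>n. (n choose m) * Stirling m i * Stirling (Suc (n - m)) (Suc k)) =
      Suc k * ?T i (Suc k) + ?T i k" for k i
    by (simp add: sum.distrib sum_distrib_left algebra_simps)
  show ?case
  proof (cases i)
    case 0
    \<comment> \<open>Only m = 0 contributes, since \<open>Stirling (Suc m) 0\<close> is 0.\<close>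
    then show ?thesis
      by (subst sum.atMost_Suc_shift) (simp del: Stirling.simps(4) binomial_Suc_Suc)
  next
    case i: (Suc k)
    show ?thesis
    proof (cases j)
      case 0
      \<comment> \<open>The second sum of \<open>rec\<close> vanishes, all its factors
        \<open>Stirling (Suc (n - m)) 0\<close> being 0.\<close>
      show ?thesis
        by (simp only: i rec left Suc.IH[symmetric] 0) simp
    next
      case j: (Suc l)
      \<comment> \<open>The weights \<open>Suc k\<close> and \<open>Suc l\<close> add up to i + j,
        and Pascal's rule merges the two remaining binomials.\<close>
      show ?thesis
        by (simp only: i j rec left right Suc.IH[symmetric]) (simp add: algebra_simps)
    qed
  qed
qed

lemma coeff_exponential_poly: "coeff (exponential_poly n) k = real (Stirling n k)"
  by (auto simp: exponential_poly_def coeff_sum if_distrib cong: if_cong)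

lemma degree_exponential_poly_le: "degree (exponential_poly n) \<le> n"
  by (rule degree_le) (simp add: coeff_exponential_poly)

lemma higher_pderiv_exponential_poly:
  "(pderiv ^^ u) (exponential_poly n) =
    (\<Sum>m\<le>n. smult (fact u * real (n choose m) * real (Stirling m u)) (exponential_poly (n - m)))"
proof (rule poly_eqI)
  fix j
  \<comment> \<open>The factor (j+1)...(j+u) arises from differentiating x^(u+j) u times; the
    binomial form matches \<open>Stirling_convolution\<close>.\<close>
  have "pochhammer (real (Suc j)) u = fact u * real ((u + j) choose u)"
    by (simp add: binomial_gbinomial gbinomial_pochhammer' add.commute)
  then have "coeff ((pderiv ^^ u) (exponential_poly n)) j =
      fact u * real (((u + j) choose u) * Stirling n (u + j))"
    by (simp add: coeff_higher_pderiv coeff_exponential_poly add.commute)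
  also have "\<dots> = coeff (\<Sum>m\<le>n. smult (fact u * real (n choose m) * real (Stirling m u))
      (exponential_poly (n - m))) j"
    by (simp add: Stirling_convolution coeff_sum coeff_exponential_poly sum_distrib_left mult.assoc)
  finally show "coeff ((pderiv ^^ u) (exponential_poly n)) j = \<dots>" .
qed

lemma gbinomial_mult_fact_eq_falling_factorial:
  "(a gchoose m) * fact m = falling_factorial a m"
  by (simp add: gbinomial_prod_rev falling_factorial_def atLeast0LessThan)

theorem theorem4p9:
  fixes S :: "real set"
    and dom :: "real \<Rightarrow> (real \<Rightarrow> real) set"
    and D :: "real \<Rightarrow> (real \<Rightarrow> real) \<Rightarrow> real \<Rightarrow> real"
    and n :: nat and a :: real and f :: "real \<Rightarrow> real" and x :: real
  assumes "fractional_differentiation S dom D"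
    and "f differentiable_on S"
    and "(\<lambda>x. poly (exponential_poly n) x * f x) \<in> dom a"
    and "\<And>u. u \<le> n \<Longrightarrow> falling_factorial a u \<noteq> 0 \<Longrightarrow> f \<in> dom (a - real u)"
    and "x \<in> S"
  shows "D a (\<lambda>x. poly (exponential_poly n) x * f x) x =
    (\<Sum>m=0..n. \<Sum>u=0..m. real (n choose m) * real (Stirling m u)
      * poly (exponential_poly (n - m)) x * falling_factorial a u * D (a - real u) f x)"
proof -
  interpret fractional_differentiation S dom D by fact
  let ?t = "\<lambda>u. (a gchoose u) * D (a - real u) f x * poly ((pderiv ^^ u) (exponential_poly n)) x"
  let ?s = "\<lambda>m u. real (n choose m) * real (Stirling m u) * poly (exponential_poly (n - m)) x
    * falling_factorial a u * D (a - real u) f x"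
  have "?t sums D a (\<lambda>x. poly (exponential_poly n) x * f x) x"
  proof (rule Leibniz[OF assms(3) _ assms(5)])
    fix u assume "u \<le> degree (exponential_poly n)" "a gchoose u \<noteq> 0"
    then show "f \<in> dom (a - real u)"
      using degree_exponential_poly_le[of n]
      by (intro assms(4)) (simp_all flip: gbinomial_mult_fact_eq_falling_factorial)
  qed
  moreover have "?t sums (\<Sum>u\<le>n. ?t u)"
    \<comment> \<open>For u > n the u-th derivative is zero: \<open>Stirling m u\<close> is 0
      whenever m \<le> n < u.\<close>
    by (rule sums_finite) (simp_all add: higher_pderiv_exponential_poly)
  ultimately have "D a (\<lambda>x. poly (exponential_poly n) x * f x) x = (\<Sum>u\<le>n. ?t u)"
    by (rule sums_unique2)
  also have "\<dots> = (\<Sum>u\<le>n. \<Sum>m\<le>n. ?s m u)"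
    by (simp add: higher_pderiv_exponential_poly poly_sum sum_distrib_left mult_ac
        flip: gbinomial_mult_fact_eq_falling_factorial)
  also have "\<dots> = (\<Sum>m\<le>n. \<Sum>u\<le>n. ?s m u)"
    by (rule sum.swap)
  also have "\<dots> = (\<Sum>m=0..n. \<Sum>u=0..m. ?s m u)"
    unfolding atLeast0AtMost
    \<comment> \<open>The discarded terms have u > m, where \<open>Stirling m u\<close> is
      0.\<close>
    by (intro sum.cong sum.mono_neutral_right) auto
  finally show ?thesis .
qed

end
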